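(* Consider iteration $k$ of the exact linesearch method (described in the context) applied to the minimization of $\frac12 x^THx+c^Tx$ with $H=H^T\succ0$, where $1\le k<r$. Assume that $p_i=\delta_i p_i^{CG}$ with $\delta_i\ne 0$ for $i=0,\dots,k-1$, where $p_i^{CG}$, $i=0,\dots,k-1$, are the search directions of the method of conjugate gradients. Let $B_k$ and $p_k$ satisfy $B_kp_k=-g_k$, and let $B_{k-1}\in\mathbb{R}^{n\times n}$ be a nonsingular matrix such that $B_{k-1}p_{k-1}=-g_{k-1}$ and $B_{k-1}g_k=g_k$. Let $\hat\gamma_k$, $\gamma_k(\cdot)$ and $\delta_k(\cdot)$ be as defined in the context. (1) For any scalar $\gamma_k$, except $\gamma_k=0$, $\gamma_k=\hat\gamma_k$ and $\gamma_k=1$, let $B_k$ be defined by $$( * )\qquad B_k=B_{k-1}-\frac1{(\gamma_k-1)\,p_{k-1}^Tg_{k-1}}(\gamma_kg_k-g_{k-1})(\gamma_kg_k-g_{k-1})^T.$$ Then $B_k$ is nonsingular and $p_k=\delta_kp_k^{CG}$ for $\delta_k=\delta_k(\gamma_k)$. (2) Conversely, for any scalar $\delta_k$, except $\delta_k=0$, $\delta_k=\delta_k(1)$ and $\delta_k=1$, assume that $p_k=\delta_kp_k^{CG}$ and assume that $B_k-B_{k-1}$ is symmetric and of rank one. Then $B_k$ is a nonsingular matrix given by $( * )$ for $\gamma_k=\gamma_k(\delta_k)$. (3) If, in addition, $B_{k-1}=B_{k-1}^T\succ0$, then $B_k$ defined by $( * )$ (with $\gamma_k\notin\{0,\hat\gamma_k,1\}$)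 satisfies $B_k\succ0$ if and only if $\gamma_k>1$ or $\hat\gamma_k<\gamma_k<0$, or equivalently if and only if $\gamma_k=\gamma_k(\delta_k)$ for $0<\delta_k<\delta_k(1)$ or $\delta_k>1$. (4) Finally, if $B_ip_i=-g_i$, $i=0,\dots,k$, with $B_0=I$, and if, for $i=1,\dots,k$, $B_{i-1}$ is updated to $B_i$ according to $( * )$ (with $k$ replaced by $i$) for $\gamma_i$ such that $\gamma_i\ne0$, $\gamma_i\ne\hat\gamma_i$ and $\gamma_i\ne1$, then $$B_kp_i=\frac{\gamma_{i+1}\theta_i}{\gamma_{i+1}-1}Hp_i,\qquad i=0,\dots,k-1.$$
   Context: Let $H\in\mathbb{R}^{n\times n}$ with $H=H^T\succ0$ and $c\in\mathbb{R}^n$. Here $X\succ0$ means that $X$ is positive definite, i.e. $x^TXx>0$ for all $x\neq0$. Exact linesearch method: given $x_0\in\mathbb{R}^n$, set $g_0=Hx_0+c$; for $k=0,1,\dots$, as long as $g_k\ne0$, choose a search direction $p_k$ and set $$\theta_k=-\frac{g_k^Tp_k}{p_k^THp_k},\quad x_{k+1}=x_k+\theta_kp_k,\quad g_{k+1}=g_k+\theta_kHp_k .$$ The index $r$ denotes the iteration at which the method terminates, i.e. the first index with $g_r=0$; so $k<r$ means $g_0,\dots,g_k$ are all nonzero. The method of conjugate gradients (CG) is the exact linesearch method with search directions $p_0^{CG}=-g_0$ and $p_k^{CG}=-g_k+\frac{g_k^Tg_k}{g_{k-1}^Tg_{k-1}}p_{k-1}^{CG}$ for $k\ge1$. CG and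 the method under consideration are started from the same $x_0$; when $p_i=\delta_ip_i^{CG}$ with $\delta_i\neq0$ for $i=0,\dots,k-1$, the iterates $x_i$ and gradients $g_i$, $i=0,\dots,k$, of the two methods coincide. Define $\hat\gamma_k=\dfrac{p_{k-1}^Tg_{k-1}}{g_k^Tg_k}$ (and $\hat\gamma_i$ likewise for other indices $i\ge1$), and for $\delta_k\ne0$ and $\gamma_k\ne\hat\gamma_k$ define the functions $$\gamma_k(\delta_k)=-\frac{p_{k-1}^Tg_{k-1}}{g_k^Tg_k}\Big(\frac1{\delta_k}-1\Big),\qquad \delta_k(\gamma_k)=\frac1{1-\gamma_k\frac{g_k^Tg_k}{p_{k-1}^Tg_{k-1}}},$$ which are inverses of each other. *)

theory Defs
  imports "HOL-Analysis.Analysis"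
begin

definition pos_def :: "real^'n^'n \<Rightarrow> bool" where
  "pos_def A \<longleftrightarrow> (\<forall>x. x \<noteq> 0 \<longrightarrow> x \<bullet> (A *v x) > 0)"

definition outer :: "real^'n \<Rightarrow> real^'n \<Rightarrow> real^'n^'n" where
  "outer u v = (\<chi> i j. u $ i * v $ j)"

definition step_length :: "real^'n^'n \<Rightarrow> (nat \<Rightarrow> real^'n) \<Rightarrow> (nat \<Rightarrow> real^'n) \<Rightarrow> nat \<Rightarrow> real" where
  "step_length H g p k = - (g k \<bullet> p k) / (p k \<bullet> (H *v p k))"

text \<open>
  The sequences \<open>x\<close>, \<open>g\<close>, \<open>p\<close> are constrained only as long as the method has not
  terminated: step \<open>k\<close> is performed iff \<open>g 0, \<dots>, g k\<close> are all nonzero, and the values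
  after termination are arbitrary.
\<close>

definition exact_linesearch ::
  "real^'n^'n \<Rightarrow> real^'n \<Rightarrow> (nat \<Rightarrow> real^'n) \<Rightarrow> (nat \<Rightarrow> real^'n) \<Rightarrow> (nat \<Rightarrow> real^'n) \<Rightarrow> bool" where
  "exact_linesearch H c x g p \<longleftrightarrow>
     g 0 = H *v x 0 + c \<and>
     (\<forall>k. (\<forall>i\<le>k. g i \<noteq> 0) \<longrightarrow>
        x (Suc k) = x k + step_length H g p k *\<^sub>R p k \<and>
        g (Suc k) = g k + step_length H g p k *\<^sub>R (H *v p k))"

definition conjugate_gradients ::
  "real^'n^'n \<Rightarrow> real^'n \<Rightarrow> (nat \<Rightarrow> real^'n) \<Rightarrow> (nat \<Rightarrow> real^'n) \<Rightarrow> (nat \<Rightarrow> real^'n) \<Rightarrow> bool" where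
  "conjugate_gradients H c x g p \<longleftrightarrow>
     exact_linesearch H c x g p \<and>
     (\<forall>k. (\<forall>i\<le>k. g i \<noteq> 0) \<longrightarrow>
        p k = (if k = 0 then - g 0
               else - g k + ((g k \<bullet> g k) / (g (k - 1) \<bullet> g (k - 1))) *\<^sub>R p (k - 1)))"

definition gamma_hat :: "(nat \<Rightarrow> real^'n) \<Rightarrow> (nat \<Rightarrow> real^'n) \<Rightarrow> nat \<Rightarrow> real" where
  "gamma_hat g p k = (p (k - 1) \<bullet> g (k - 1)) / (g k \<bullet> g k)"

definition gamma_fun :: "(nat \<Rightarrow> real^'n) \<Rightarrow> (nat \<Rightarrow> real^'n) \<Rightarrow> nat \<Rightarrow> real \<Rightarrow> real" where
  "gamma_fun g p k \<delta> = - ((p (k - 1) \<bullet> g (k - 1)) / (g k \<bullet> g k)) * (1 / \<delta> - 1)"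

text \<open>
  \<open>delta_fun g p k \<gamma>\<close> is meaningful for \<open>\<gamma> \<noteq> gamma_hat g p k\<close>; at the excluded point
  division by zero gives the value 0, so there \<open>\<delta> \<noteq> delta_fun g p k \<gamma>\<close> amounts to \<open>\<delta> \<noteq> 0\<close>.
\<close>

definition delta_fun :: "(nat \<Rightarrow> real^'n) \<Rightarrow> (nat \<Rightarrow> real^'n) \<Rightarrow> nat \<Rightarrow> real \<Rightarrow> real" where
  "delta_fun g p k \<gamma> = 1 / (1 - \<gamma> * ((g k \<bullet> g k) / (p (k - 1) \<bullet> g (k - 1))))"

definition rank_one_update ::
  "(nat \<Rightarrow> real^'n) \<Rightarrow> (nat \<Rightarrow> real^'n) \<Rightarrow> nat \<Rightarrow> real \<Rightarrow> real^'n^'n \<Rightarrow> real^'n^'n" where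
  "rank_one_update g p k \<gamma> B =
     B - (1 / ((\<gamma> - 1) * (p (k - 1) \<bullet> g (k - 1)))) *\<^sub>R
           outer (\<gamma> *\<^sub>R g k - g (k - 1)) (\<gamma> *\<^sub>R g k - g (k - 1))"

end

theory Submission
  imports Defs
begin

text \<open>
  Write \<open>s = p (k - 1) \<bullet> g (k - 1)\<close>, \<open>G = g k \<bullet> g k\<close>, \<open>u = \<gamma> g k - g (k - 1)\<close> and
  \<open>w = \<gamma> g k + p (k - 1)\<close>. The hypotheses on \<open>B (k - 1)\<close> say \<open>B (k - 1) w = u\<close>, and the
  orthogonality relations of CG give \<open>u \<bullet> w = \<gamma>\<^sup>2 G - s\<close>. So the Sherman--Morrison factor of the
  update is \<open>1 - u \<bullet> w / ((\<gamma> - 1) s) = \<gamma> (s - \<gamma> G) / ((\<gamma> - 1) s)\<close>; it vanishes only at the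
  excluded values of \<open>\<gamma>\<close>, and for positive definite \<open>B (k - 1)\<close> its sign decides whether the
  update is positive definite, by Cauchy--Schwarz in the inner product of \<open>B (k - 1)\<close>.
  Conversely, a symmetric rank-one matrix \<open>E\<close> is determined by a single nonzero value \<open>E v\<close>.
  The last claim holds because \<open>g (j - 1)\<close> and \<open>g j\<close> are orthogonal to \<open>p i\<close> for
  \<open>i < j - 1\<close>, so that later updates do not change the image of \<open>p i\<close>.
\<close>

section \<open>Linear algebra of symmetric and rank-one matrices\<close>

lemma outer_mult_vec: "outer u v *v z = (v \<bullet> z) *\<^sub>R u"
  by (simp add: vec_eq_iff outer_def matrix_vector_mult_def inner_vec_def
      sum_distrib_left mult_ac)

lemma outer_scaleR: "outer (a *\<^sub>R u) (b *\<^sub>R v) = (a * b) *\<^sub>R outer u v"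
  by (simp add: vec_eq_iff outer_def)

lemma symmetric_inner_mult_vec:
  fixes A :: "real^'n^'n"
  assumes "transpose A = A"
  shows "y \<bullet> (A *v z) = z \<bullet> (A *v y)"
  by (metis assms dot_lmul_matrix inner_commute transpose_matrix_vector)

lemma invertible_iff_trivial_kernel:
  fixes A :: "real^'n^'n"
  shows "invertible A \<longleftrightarrow> (\<forall>z. A *v z = 0 \<longrightarrow> z = 0)"
  by (simp add: invertible_left_inverse matrix_left_invertible_ker)

text \<open>The form of \<open>A\<close> is nonnegative at \<open>a z - b y\<close>, which is
  \<open>a\<close> times the part of \<open>z\<close> that is \<open>A\<close>-orthogonal to
  \<open>y\<close>; scaling by \<open>a\<close> avoids a division.\<close>

lemma pos_def_Cauchy_Schwarz:
  assumes sym: "transpose A = A" and pd: "pos_def A"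
  shows "(y \<bullet> (A *v z))\<^sup>2 \<le> (y \<bullet> (A *v y)) * (z \<bullet> (A *v z))"
proof (cases "y = 0")
  case False
  define a b where "a = y \<bullet> (A *v y)" and "b = y \<bullet> (A *v z)"
  have a: "a > 0" using pd False by (simp add: pos_def_def a_def)
  let ?v = "a *\<^sub>R z - b *\<^sub>R y"
  have nonneg: "0 \<le> ?v \<bullet> (A *v ?v)"
    using pd by (cases "?v = 0") (auto simp: pos_def_def less_imp_le)
  have "z \<bullet> (A *v y) = b"
    by (simp add: b_def symmetric_inner_mult_vec[OF sym])
  then have "?v \<bullet> (A *v ?v) = a * (a * (z \<bullet> (A *v z)) - b\<^sup>2)"
    by (simp add: matrix_vector_mult_diff_distrib matrix_vector_mult_scaleR inner_diff_left
        inner_diff_right a_def[symmetric] b_def[symmetric] power2_eq_square algebra_simps)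
  with nonneg a have "b\<^sup>2 \<le> a * (z \<bullet> (A *v z))"
    by (simp add: zero_le_mult_iff)
  then show ?thesis by (simp add: a_def b_def)
qed simp

text \<open>The range is the line through \<open>y = E v\<close>, so \<open>E z\<close> is a
  multiple \<open>a z\<close> of \<open>y\<close>, and symmetry evaluates that multiple.\<close>

lemma symmetric_rank_one_eq_outer:
  fixes E :: "real^'n^'n"
  assumes sym: "transpose E = E" and rank: "rank E = 1" and nz: "E *v v \<noteq> 0"
  shows "E = (1 / ((E *v v) \<bullet> v)) *\<^sub>R outer (E *v v) (E *v v)"
proof -
  let ?y = "E *v v"
  have "dim (range (\<lambda>z. E *v z)) = 1" using rank by (simp add: rank_dim_range)
  moreover have "independent {?y}" using nz by simp
  ultimately have "range (\<lambda>z. E *v z) \<subseteq> span {?y}"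
    by (intro card_ge_dim_independent) auto
  then have "\<exists>a. E *v z = a *\<^sub>R ?y" for z
    by (auto simp: span_singleton)
  then obtain a where a: "\<And>z. E *v z = a z *\<^sub>R ?y" by metis
  have az: "a z * (?y \<bullet> v) = ?y \<bullet> z" for z
    using symmetric_inner_mult_vec[OF sym, of v z] a[of z]
    by (simp add: inner_commute)
  \<comment> \<open>At \<open>z = y\<close> the right side of \<open>az\<close> is the squared norm
    of \<open>y\<close>, which is nonzero.\<close>
  have "?y \<bullet> v \<noteq> 0"
    using az[of ?y] nz by auto
  then have "a z = (?y \<bullet> z) / (?y \<bullet> v)" for z
    using az[of z] by (simp add: field_simps)
  then have "E *v z = ((1 / (?y \<bullet> v)) *\<^sub>R outer ?y ?y) *v z" for z
    using a[of z] by (simp add: outer_mult_vec flip: scaleR_matrix_vector_assoc)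
  then show ?thesis by (intro matrix_eq[THEN iffD2] allI)
qed


section \<open>One symmetric rank-one update\<close>

lemma rank_one_update_mult_vec:
  "rank_one_update g p k \<gamma> B *v z = B *v z -
     (((\<gamma> *\<^sub>R g k - g (k - 1)) \<bullet> z) / ((\<gamma> - 1) * (p (k - 1) \<bullet> g (k - 1)))) *\<^sub>R
       (\<gamma> *\<^sub>R g k - g (k - 1))"
  by (simp add: rank_one_update_def matrix_vector_mult_diff_rdistrib outer_mult_vec
      flip: scaleR_matrix_vector_assoc)

text \<open>Collects what CG provides about one iteration, so that the first three claims become
  algebra about \<open>B\<close> and four vectors, without reference to \<open>H\<close>.\<close>

locale rank_one_step =
  fixes g p :: "nat \<Rightarrow> real^'n" and k :: nat and B :: "real^'n^'n"
  assumes ortho_gg: "g k \<bullet> g (k - 1) = 0"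
    and ortho_gp: "g k \<bullet> p (k - 1) = 0"
    and gk_nz: "g k \<noteq> 0"
    and s_nz: "p (k - 1) \<bullet> g (k - 1) \<noteq> 0"
    and B_p: "B *v p (k - 1) = - g (k - 1)"
    and B_g: "B *v g k = g k"
begin

declare One_nat_def [simp del]

definition s where "s = p (k - 1) \<bullet> g (k - 1)"
definition G where "G = g k \<bullet> g k"
definition u where "u \<gamma> = \<gamma> *\<^sub>R g k - g (k - 1)"
definition w where "w \<gamma> = \<gamma> *\<^sub>R g k + p (k - 1)"
text \<open>The CG direction, written in terms of an arbitrary multiple of the previous one.\<close>
definition d where "d = - g k - (G / s) *\<^sub>R p (k - 1)"

lemma s_neq_0: "s \<noteq> 0" using s_nz by (simp add: s_def)

lemma G_pos: "G > 0" using gk_nz by (simp add: G_def)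

lemma gamma_hat_eq: "gamma_hat g p k = s / G"
  by (simp add: gamma_hat_def s_def G_def)

lemma gamma_fun_eq: "gamma_fun g p k \<delta> = - (s / G) * (1 / \<delta> - 1)"
  by (simp add: gamma_fun_def s_def G_def)

lemma delta_fun_eq: "delta_fun g p k \<gamma> = 1 / (1 - \<gamma> * (G / s))"
  by (simp add: delta_fun_def s_def G_def)

lemma rank_one_update_eq:
  "rank_one_update g p k \<gamma> B = B - (1 / ((\<gamma> - 1) * s)) *\<^sub>R outer (u \<gamma>) (u \<gamma>)"
  by (simp add: rank_one_update_def s_def u_def)

lemma update_mult_vec:
  "rank_one_update g p k \<gamma> B *v z = B *v z - ((u \<gamma> \<bullet> z) / ((\<gamma> - 1) * s)) *\<^sub>R u \<gamma>"
  by (simp add: rank_one_update_mult_vec s_def u_def)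

lemma B_w: "B *v w \<gamma> = u \<gamma>"
  by (simp add: w_def u_def matrix_vector_right_distrib matrix_vector_mult_scaleR B_p B_g)

lemma u_inner_w: "u \<gamma> \<bullet> w \<gamma> = \<gamma>\<^sup>2 * G - s"
  using ortho_gg ortho_gp
  by (simp add: u_def w_def s_def G_def inner_diff_left inner_diff_right inner_add_right
      inner_commute power2_eq_square)

lemma u_inner_g: "u \<gamma> \<bullet> g k = \<gamma> * G"
  using ortho_gg by (simp add: u_def G_def inner_diff_left inner_diff_right inner_commute)

lemma u_inner_p: "u \<gamma> \<bullet> p (k - 1) = - s"
  using ortho_gp by (simp add: u_def s_def inner_diff_left inner_diff_right inner_commute)

lemma u_inner_d: "u \<gamma> \<bullet> d = - (\<gamma> - 1) * G"
  using s_neq_0 by (simp add: d_def inner_diff_right u_inner_g u_inner_p algebra_simps)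

lemma B_d: "B *v d = - g k + (G / s) *\<^sub>R g (k - 1)"
proof -
  have "d = (- 1) *\<^sub>R g k - (G / s) *\<^sub>R p (k - 1)"
    by (simp add: d_def)
  then show ?thesis
    by (simp only: matrix_vector_mult_diff_distrib matrix_vector_mult_scaleR B_p B_g) simp
qed

text \<open>For invertible \<open>B\<close> and \<gamma> other than 1 this is the ratio of the
  determinants of the update and of \<open>B\<close>. The zeros of the numerator are 0 and
  \<open>s / G\<close>, the value of \<open>gamma_hat\<close>.\<close>

definition factor where "factor \<gamma> = \<gamma> * (s - \<gamma> * G) / ((\<gamma> - 1) * s)"

lemma factor_eq:
  assumes "\<gamma> \<noteq> 1"
  shows "1 - (u \<gamma> \<bullet> w \<gamma>) / ((\<gamma> - 1) * s) = factor \<gamma>"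
proof -
  have "(\<gamma> - 1) * s \<noteq> 0" using assms s_neq_0 by simp
  then have "1 - (u \<gamma> \<bullet> w \<gamma>) / ((\<gamma> - 1) * s) = ((\<gamma> - 1) * s - (\<gamma>\<^sup>2 * G - s)) / ((\<gamma> - 1) * s)"
    by (simp add: u_inner_w diff_divide_distrib)
  also have "(\<gamma> - 1) * s - (\<gamma>\<^sup>2 * G - s) = \<gamma> * (s - \<gamma> * G)"
    by (simp add: algebra_simps power2_eq_square)
  finally show ?thesis by (simp add: factor_def)
qed

lemma factor_neq_0:
  assumes "\<gamma> \<noteq> 0" "\<gamma> \<noteq> gamma_hat g p k" "\<gamma> \<noteq> 1"
  shows "factor \<gamma> \<noteq> 0"
proof -
  have "s \<noteq> \<gamma> * G" using assms(2) G_pos by (auto simp: gamma_hat_eq)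
  then show ?thesis using assms s_neq_0 by (simp add: factor_def)
qed

section \<open>Nonsingularity of the update and its search direction\<close>

text \<open>A kernel vector \<open>z\<close> satisfies \<open>B z = a u = B (a w)\<close>, hence
  \<open>z = a w\<close>. Inserting this into the definition of \<open>a\<close> leaves
  \<open>a * factor = 0\<close>.\<close>

lemma invertible_update:
  assumes inv: "invertible B"
    and \<gamma>: "\<gamma> \<noteq> 0" "\<gamma> \<noteq> gamma_hat g p k" "\<gamma> \<noteq> 1"
  shows "invertible (rank_one_update g p k \<gamma> B)"
  unfolding invertible_iff_trivial_kernel
proof (intro allI impI)
  fix z
  assume z: "rank_one_update g p k \<gamma> B *v z = 0"
  define a where "a = (u \<gamma> \<bullet> z) / ((\<gamma> - 1) * s)"
  have "B *v (z - a *\<^sub>R w \<gamma>) = 0"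
    using z by (simp add: update_mult_vec a_def[symmetric] B_w matrix_vector_mult_diff_distrib
        matrix_vector_mult_scaleR)
  then have z_eq: "z = a *\<^sub>R w \<gamma>"
    using inv unfolding invertible_iff_trivial_kernel by (metis eq_iff_diff_eq_0)
  have "a = a * ((u \<gamma> \<bullet> w \<gamma>) / ((\<gamma> - 1) * s))"
    by (subst a_def, subst z_eq, simp)
  then have "a * factor \<gamma> = 0"
    by (simp add: factor_eq[OF \<gamma>(3), symmetric] algebra_simps)
  then show "z = 0" using factor_neq_0[OF \<gamma>] z_eq by simp
qed

text \<open>The coefficient of \<open>u\<close> in the update at \<open>d\<close> is
  \<open>- (G / s)\<close> for every admissible \<gamma>, just what cancels the
  \<open>g (k - 1)\<close> component of \<open>B d\<close>.\<close>

lemma update_mult_d: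
  assumes "\<gamma> \<noteq> 1"
  shows "rank_one_update g p k \<gamma> B *v d = - (1 - \<gamma> * (G / s)) *\<^sub>R g k"
proof -
  have "(u \<gamma> \<bullet> d) / ((\<gamma> - 1) * s) = - (G / s)"
    using assms s_neq_0 by (simp add: u_inner_d divide_simps) (simp add: algebra_simps)
  then have "rank_one_update g p k \<gamma> B *v d
      = - g k + (G / s) *\<^sub>R g (k - 1) + (G / s) *\<^sub>R u \<gamma>"
    by (simp add: update_mult_vec B_d)
  also have "\<dots> = - (1 - \<gamma> * (G / s)) *\<^sub>R g k"
    by (simp add: u_def algebra_simps)
  finally show ?thesis .
qed

text \<open>The stated multiple of \<open>d\<close> solves the same system, whose solution is
  unique.\<close>

lemma direction_of_update:
  assumes inv: "invertible B"
    and \<gamma>: "\<gamma> \<noteq> 0" "\<gamma> \<noteq> gamma_hat g p k" "\<gamma> \<noteq> 1"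
    and eq: "rank_one_update g p k \<gamma> B *v q = - g k"
  shows "q = delta_fun g p k \<gamma> *\<^sub>R d"
proof -
  let ?C = "rank_one_update g p k \<gamma> B"
  define b where "b = 1 - \<gamma> * (G / s)"
  have "b \<noteq> 0"
    using \<gamma> s_neq_0 G_pos by (auto simp: b_def gamma_hat_eq field_simps)
  then have "?C *v (delta_fun g p k \<gamma> *\<^sub>R d) = - g k"
    by (simp only: matrix_vector_mult_scaleR update_mult_d[OF \<gamma>(3)] delta_fun_eq
        b_def[symmetric]) simp
  then have "?C *v (q - delta_fun g p k \<gamma> *\<^sub>R d) = 0"
    using eq by (simp add: matrix_vector_mult_diff_distrib)
  then show ?thesis
    using invertible_update[OF inv \<gamma>] unfolding invertible_iff_trivial_kernel
    by (metis eq_iff_diff_eq_0)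
qed

section \<open>From the search direction back to the update\<close>

text \<open>The excluded values correspond: \<delta> = 1 gives 0 and
  \<open>delta_fun g p k 1\<close> gives 1, while \<open>gamma_hat\<close> is the limit for infinite
  \<delta> and is not attained at nonzero \<delta>.\<close>

lemma gamma_fun_admissible:
  assumes "\<delta> \<noteq> 0" "\<delta> \<noteq> delta_fun g p k 1" "\<delta> \<noteq> 1"
  shows "gamma_fun g p k \<delta> \<noteq> 0" "gamma_fun g p k \<delta> \<noteq> gamma_hat g p k"
    "gamma_fun g p k \<delta> \<noteq> 1"
proof -
  show "gamma_fun g p k \<delta> \<noteq> 0" "gamma_fun g p k \<delta> \<noteq> gamma_hat g p k"
    using assms s_neq_0 G_pos by (auto simp: gamma_fun_eq gamma_hat_eq field_simps)
  show "gamma_fun g p k \<delta> \<noteq> 1"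
  proof
    assume "gamma_fun g p k \<delta> = 1"
    then have "1 / \<delta> = 1 - G / s"
      using s_neq_0 G_pos assms(1) by (simp add: gamma_fun_eq field_simps)
    then have "\<delta> = delta_fun g p k 1"
      using assms(1) by (simp add: delta_fun_eq flip: \<open>1 / \<delta> = 1 - G / s\<close>)
    with assms(2) show False ..
  qed
qed

text \<open>The hypotheses fix the image of \<delta> \<open>d\<close> under \<open>C - B\<close>; it
  is a nonzero multiple of \<open>u\<close>, which determines a symmetric rank-one matrix.\<close>

lemma update_of_direction:
  assumes \<delta>: "\<delta> \<noteq> 0" "\<delta> \<noteq> delta_fun g p k 1" "\<delta> \<noteq> 1"
    and eq: "C *v (\<delta> *\<^sub>R d) = - g k"
    and sym: "transpose (C - B) = C - B" and rank: "rank (C - B) = 1"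
  shows "C = rank_one_update g p k (gamma_fun g p k \<delta>) B"
proof -
  define \<gamma> where "\<gamma> = gamma_fun g p k \<delta>"
  \<comment> \<open>\<open>- t\<close> is the coefficient of \<open>g (k - 1)\<close> in the image
    of \<delta> \<open>d\<close> under \<open>C - B\<close>. Matching the coefficient of
    \<open>g k\<close> with that in \<open>t u\<close> requires
    \<open>t \<gamma> = \<delta> - 1\<close>, which is solved by \<open>gamma_fun\<close>.\<close>
  define t where "t = \<delta> * G / s"
  have t_nz: "t \<noteq> 0" using \<delta> s_neq_0 G_pos by (simp add: t_def)
  have \<gamma>: "\<gamma> \<noteq> 0" "\<gamma> \<noteq> 1" using gamma_fun_admissible[OF \<delta>] by (simp_all add: \<gamma>_def)
  have t\<gamma>: "t * \<gamma> = \<delta> - 1"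
    using \<delta>(1) s_neq_0 G_pos by (simp add: t_def \<gamma>_def gamma_fun_eq field_simps)
  have "(C - B) *v (\<delta> *\<^sub>R d) = - g k - \<delta> *\<^sub>R (- g k + (G / s) *\<^sub>R g (k - 1))"
    by (simp only: matrix_vector_mult_diff_rdistrib eq) (simp add: matrix_vector_mult_scaleR B_d)
  also have "\<dots> = t *\<^sub>R u \<gamma>"
  proof -
    have "t *\<^sub>R u \<gamma> = (\<delta> - 1) *\<^sub>R g k - t *\<^sub>R g (k - 1)"
      by (simp add: u_def scaleR_diff_right t\<gamma>)
    then show ?thesis by (simp add: algebra_simps t_def)
  qed
  finally have y: "(C - B) *v (\<delta> *\<^sub>R d) = t *\<^sub>R u \<gamma>" .
  have "u \<gamma> \<noteq> 0" using u_inner_g[of \<gamma>] \<gamma> G_pos by auto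
  then have "C - B = (1 / (t *\<^sub>R u \<gamma> \<bullet> \<delta> *\<^sub>R d)) *\<^sub>R outer (t *\<^sub>R u \<gamma>) (t *\<^sub>R u \<gamma>)"
    using symmetric_rank_one_eq_outer[OF sym rank, of "\<delta> *\<^sub>R d"] y t_nz by simp
  also have "\<dots> = (t / (\<delta> * (- (\<gamma> - 1) * G))) *\<^sub>R outer (u \<gamma>) (u \<gamma>)"
    using t_nz by (simp add: outer_scaleR u_inner_d)
  also have "t / (\<delta> * (- (\<gamma> - 1) * G)) = - (1 / ((\<gamma> - 1) * s))"
    using \<delta>(1) \<gamma>(2) s_neq_0 G_pos by (simp add: t_def divide_simps)
  finally show ?thesis
    by (simp add: rank_one_update_eq \<gamma>_def[symmetric] algebra_simps)
qed

section \<open>Positive definiteness of the update\<close>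

lemma s_neg:
  assumes "pos_def B"
  shows "s < 0"
proof -
  have "p (k - 1) \<noteq> 0" using s_nz by auto
  then have "p (k - 1) \<bullet> (B *v p (k - 1)) > 0" using assms by (simp add: pos_def_def)
  then show ?thesis by (simp add: B_p s_def)
qed

text \<open>At \<open>w\<close> the updated form equals \<open>(u \<bullet> w) * factor\<close>,
  which gives necessity. For sufficiency, Cauchy-Schwarz for \<open>z\<close> and \<open>w\<close>
  bounds the updated form from below by \<open>factor\<close> times the old one if
  \<open>a > 0\<close>; if \<open>a \<le> 0\<close>, the form does not decrease.\<close>

lemma pos_def_update_iff_factor:
  assumes sym: "transpose B = B" and pd: "pos_def B"
    and \<gamma>: "\<gamma> \<noteq> 0" "\<gamma> \<noteq> 1"
  shows "pos_def (rank_one_update g p k \<gamma> B) \<longleftrightarrow> factor \<gamma> > 0"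
proof -
  let ?C = "rank_one_update g p k \<gamma> B"
  define a where "a = 1 / ((\<gamma> - 1) * s)"
  have quad: "z \<bullet> (?C *v z) = z \<bullet> (B *v z) - a * (u \<gamma> \<bullet> z)\<^sup>2" for z
    by (simp add: update_mult_vec inner_diff_right a_def power2_eq_square inner_commute)
  have fac: "factor \<gamma> = 1 - a * (u \<gamma> \<bullet> w \<gamma>)"
    using factor_eq[OF \<gamma>(2)] by (simp add: a_def)
  have "u \<gamma> \<noteq> 0" using u_inner_g[of \<gamma>] \<gamma> G_pos by auto
  then have w_nz: "w \<gamma> \<noteq> 0" using B_w[of \<gamma>] by auto
  \<comment> \<open>Since \<open>u = B w\<close>, this is the form of \<open>B\<close> at
    \<open>w\<close>.\<close>
  then have uw: "u \<gamma> \<bullet> w \<gamma> > 0"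
    using pd by (metis B_w inner_commute pos_def_def)
  show ?thesis
  proof
    assume "pos_def ?C"
    then have "0 < w \<gamma> \<bullet> (?C *v w \<gamma>)" using w_nz by (simp add: pos_def_def)
    also have "\<dots> = (u \<gamma> \<bullet> w \<gamma>) * factor \<gamma>"
      by (simp add: quad B_w fac inner_commute power2_eq_square algebra_simps)
    finally show "factor \<gamma> > 0" using uw by (simp add: zero_less_mult_iff)
  next
    assume pos: "factor \<gamma> > 0"
    show "pos_def ?C"
      unfolding pos_def_def
    proof (intro allI impI)
      fix z :: "real^'n" assume "z \<noteq> 0"
      then have z: "z \<bullet> (B *v z) > 0" using pd by (simp add: pos_def_def)
      show "0 < z \<bullet> (?C *v z)"
      proof (cases "a \<le> 0")
        case True
        then have "a * (u \<gamma> \<bullet> z)\<^sup>2 \<le> 0" by (simp add: mult_nonpos_nonneg)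
        with z show ?thesis by (simp add: quad)
      next
        case False
        have "(u \<gamma> \<bullet> z)\<^sup>2 = (z \<bullet> (B *v w \<gamma>))\<^sup>2" by (simp add: B_w inner_commute)
        also have "\<dots> \<le> (z \<bullet> (B *v z)) * (u \<gamma> \<bullet> w \<gamma>)"
          using pos_def_Cauchy_Schwarz[OF sym pd, of z "w \<gamma>"] by (simp add: B_w inner_commute)
        finally have "a * (u \<gamma> \<bullet> z)\<^sup>2 \<le> a * ((z \<bullet> (B *v z)) * (u \<gamma> \<bullet> w \<gamma>))"
          using False by (intro mult_left_mono) auto
        moreover have "0 < (z \<bullet> (B *v z)) * factor \<gamma>" using z pos by simp
        ultimately show ?thesis by (simp add: quad fac algebra_simps)
      qed
    qed
  qed
qed

text \<open>Here \<open>gamma_hat\<close> is negative. For positive \<gamma> the numerator is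
  negative, so the sign of \<gamma> - 1 decides; for negative \<gamma> the denominator is positive,
  so the sign of \<open>s - \<gamma> G\<close> decides.\<close>

lemma factor_pos_iff:
  assumes s: "s < 0" and \<gamma>: "\<gamma> \<noteq> 0" "\<gamma> \<noteq> gamma_hat g p k" "\<gamma> \<noteq> 1"
  shows "factor \<gamma> > 0 \<longleftrightarrow> \<gamma> > 1 \<or> (gamma_hat g p k < \<gamma> \<and> \<gamma> < 0)"
proof -
  have hat: "gamma_hat g p k < \<gamma> \<longleftrightarrow> s < \<gamma> * G"
    using G_pos by (simp add: gamma_hat_eq divide_less_eq)
  have "s < \<gamma> * G" if "\<gamma> > 0"
    using that G_pos s by (meson less_trans mult_pos_pos)
  then show ?thesis
    using s \<gamma> unfolding hat factor_def
    by (auto simp: zero_less_divide_iff zero_less_mult_iff mult_less_0_iff)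
qed

text \<open>With \<open>h = - gamma_hat\<close>, the map from \<delta> to
  \<open>h (1 / \<delta> - 1)\<close> is a decreasing bijection from the positive reals onto the
  reals above \<open>- h\<close>. It takes the value 1 at \<open>h / (h + 1)\<close> and 0 at
  1.\<close>

lemma ex_gamma_fun_iff:
  assumes s: "s < 0"
  shows "(\<exists>\<delta>. \<gamma> = gamma_fun g p k \<delta> \<and> (0 < \<delta> \<and> \<delta> < delta_fun g p k 1 \<or> \<delta> > 1))
    \<longleftrightarrow> \<gamma> > 1 \<or> (gamma_hat g p k < \<gamma> \<and> \<gamma> < 0)"
proof -
  define h where "h = - (s / G)"
  have h: "h > 0" using s G_pos by (simp add: h_def divide_neg_pos)
  have gf: "gamma_fun g p k \<delta> = h * (1 / \<delta> - 1)" for \<delta>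
    by (simp add: gamma_fun_eq h_def)
  have hat: "gamma_hat g p k = - h" by (simp add: gamma_hat_eq h_def)
  have d1: "delta_fun g p k 1 = h / (h + 1)"
    using s G_pos by (simp add: delta_fun_eq h_def divide_simps) (simp add: algebra_simps)
  have low: "h * (1 / \<delta> - 1) > 1 \<longleftrightarrow> \<delta> < h / (h + 1)" if "\<delta> > 0" for \<delta>
    using h that by (simp add: field_simps)
  show ?thesis
  proof (intro iffI)
    assume "\<exists>\<delta>. \<gamma> = gamma_fun g p k \<delta> \<and> (0 < \<delta> \<and> \<delta> < delta_fun g p k 1 \<or> \<delta> > 1)"
    then obtain \<delta> where \<delta>: "\<gamma> = h * (1 / \<delta> - 1)" "0 < \<delta> \<and> \<delta> < h / (h + 1) \<or> \<delta> > 1"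
      by (auto simp: gf d1)
    from \<delta>(2) show "\<gamma> > 1 \<or> (gamma_hat g p k < \<gamma> \<and> \<gamma> < 0)"
    proof
      assume "0 < \<delta> \<and> \<delta> < h / (h + 1)"
      then show ?thesis using low \<delta>(1) by simp
    next
      assume "\<delta> > 1"
      then show ?thesis using h by (simp add: \<delta>(1) hat field_simps)
    qed
  next
    assume \<gamma>: "\<gamma> > 1 \<or> (gamma_hat g p k < \<gamma> \<and> \<gamma> < 0)"
    \<comment> \<open>The inverse of that map, equal to
      \<open>delta_fun g p k \<gamma>\<close>.\<close>
    define \<delta> where "\<delta> = h / (\<gamma> + h)"
    have pos: "\<gamma> + h > 0" using \<gamma> h hat by auto
    then have \<delta>_pos: "\<delta> > 0" using h by (simp add: \<delta>_def)
    have \<gamma>_eq: "\<gamma> = h * (1 / \<delta> - 1)" using h pos by (simp add: \<delta>_def field_simps)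
    have "\<delta> > 1" if "\<gamma> < 0" using that h pos by (simp add: \<delta>_def)
    moreover have "\<delta> < h / (h + 1)" if "\<gamma> > 1" using that low[OF \<delta>_pos] \<gamma>_eq by simp
    ultimately show "\<exists>\<delta>. \<gamma> = gamma_fun g p k \<delta> \<and> (0 < \<delta> \<and> \<delta> < delta_fun g p k 1 \<or> \<delta> > 1)"
      using \<gamma> \<gamma>_eq \<delta>_pos by (auto simp: gf d1)
  qed
qed

end


section \<open>Conjugate gradients\<close>

text \<open>Scaling a direction by a nonzero factor divides the step length by it, so the product of
  the two is unchanged.\<close>

lemma exact_linesearch_scaled_directions:
  assumes ls: "exact_linesearch H c x g p" and ls': "exact_linesearch H c x' g' p'"
    and start: "x' 0 = x 0"
    and nz: "\<forall>i\<le>k. g i \<noteq> 0"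
    and scaled: "\<forall>i<k. \<delta> i \<noteq> 0 \<and> p i = \<delta> i *\<^sub>R p' i"
  shows "i \<le> k \<Longrightarrow> g' i = g i"
proof (induction i rule: less_induct)
  case (less i)
  show ?case
  proof (cases i)
    case 0
    then show ?thesis using ls ls' start by (simp add: exact_linesearch_def)
  next
    case (Suc j)
    \<comment> \<open>Step \<open>j\<close> of the second method is available only if
      \<open>g' 0\<close> to \<open>g' j\<close> are all nonzero, hence the strong
      induction.\<close>
    have eq: "g' l = g l" if "l \<le> j" for l using less that Suc by simp
    have "g i = g j + step_length H g p j *\<^sub>R (H *v p j)"
      using ls nz less.prems Suc by (simp add: exact_linesearch_def)
    moreover have "g' i = g' j + step_length H g' p' j *\<^sub>R (H *v p' j)"
      using ls' nz less.prems Suc eq by (simp add: exact_linesearch_def)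
    moreover have "\<delta> j \<noteq> 0" "p j = \<delta> j *\<^sub>R p' j"
      using scaled less.prems Suc by auto
    ultimately show ?thesis
      using eq[of j] by (simp add: step_length_def matrix_vector_mult_scaleR)
  qed
qed

text \<open>Orthogonality of gradients and conjugacy of directions support each other, so they are
  carried through one induction.\<close>

lemma conjugate_gradients_relations:
  assumes sym: "transpose H = H" and pd: "pos_def H"
    and cg: "conjugate_gradients H c x g p"
    and nz: "\<forall>i\<le>k. g i \<noteq> 0"
  shows "m \<le> k \<Longrightarrow>
    (\<forall>j\<le>m. g j \<bullet> p j = - (g j \<bullet> g j) \<and>
      (\<forall>i<j. g j \<bullet> g i = 0 \<and> g j \<bullet> p i = 0 \<and> p j \<bullet> (H *v p i) = 0))"
proof (induction m)
  case 0
  have "p 0 = - g 0" using cg nz unfolding conjugate_gradients_def by (metis le0 le_zero_eq)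
  then show ?case by simp
next
  case (Suc m)
  define \<theta> where "\<theta> i = step_length H g p i" for i
  have dir0: "p 0 = - g 0" using cg nz unfolding conjugate_gradients_def by (metis le0 le_zero_eq)
  have dir: "p (Suc i) = - g (Suc i) + ((g (Suc i) \<bullet> g (Suc i)) / (g i \<bullet> g i)) *\<^sub>R p i"
    if "Suc i \<le> k" for i
    using cg nz that unfolding conjugate_gradients_def
    by (metis (no_types, lifting) diff_Suc_1 le_trans nat.distinct(1))
  have step: "g (Suc i) = g i + \<theta> i *\<^sub>R (H *v p i)" if "i \<le> k" for i
    using cg nz that unfolding conjugate_gradients_def exact_linesearch_def \<theta>_def
    by (meson le_trans)
  have IH: "g j \<bullet> p j = - (g j \<bullet> g j)"
    and IH': "i < j \<Longrightarrow> g j \<bullet> g i = 0 \<and> g j \<bullet> p i = 0 \<and> p j \<bullet> (H *v p i) = 0"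
    if "j \<le> m" for i j
    using Suc that by auto
  have gg: "g j \<bullet> g j > 0" if "j \<le> Suc m" for j using nz Suc.prems that by simp
  have p_nz: "p j \<noteq> 0" if "j \<le> m" for j
    using IH[OF that] gg[of j] that by auto
  have pHp: "p j \<bullet> (H *v p j) > 0" if "j \<le> m" for j
    using pd p_nz[OF that] by (simp add: pos_def_def)
  have \<theta>_eq: "\<theta> j * (p j \<bullet> (H *v p j)) = g j \<bullet> g j" if "j \<le> m" for j
    using IH[OF that] pHp[OF that] by (simp add: \<theta>_def step_length_def)
  have \<theta>_nz: "\<theta> j \<noteq> 0" if "j \<le> m" for j
    using \<theta>_eq[OF that] gg[of j] that by auto
  \<comment> \<open>For \<open>i = m\<close> this is exactness of the line search; for smaller
    \<open>i\<close>, conjugacy keeps the earlier orthogonality.\<close>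
  have gp: "g (Suc m) \<bullet> p i = 0" if "i \<le> m" for i
  proof (cases "i = m")
    case True
    then show ?thesis
      using step[of m] Suc.prems IH[of m] \<theta>_eq[of m]
      by (simp add: inner_add_right inner_commute[of _ "p m"])
  next
    case False
    then have "i < m" using that by simp
    then have "g m \<bullet> p i = 0" "p i \<bullet> (H *v p m) = 0"
      using IH'[of m i] symmetric_inner_mult_vec[OF sym, of "p i" "p m"] by simp_all
    then show ?thesis
      using step[of m] Suc.prems by (simp add: inner_add_right inner_commute[of _ "p i"])
  qed
  \<comment> \<open>Each \<open>g i\<close> is a combination of \<open>p i\<close> and, for positive
    \<open>i\<close>, its predecessor.\<close>
  have g_ortho: "g (Suc m) \<bullet> g i = 0" if "i \<le> m" for i
  proof (cases i)
    case 0
    then have "g i = - p i" using dir0 by simp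
    then show ?thesis using gp[OF that] by simp
  next
    case (Suc l)
    define \<beta> where "\<beta> = (g i \<bullet> g i) / (g l \<bullet> g l)"
    have "p i = - g i + \<beta> *\<^sub>R p l"
      using dir[of l] Suc that Suc.prems \<open>Suc m \<le> k\<close> by (simp add: \<beta>_def)
    then have "g i = \<beta> *\<^sub>R p l - p i" by simp
    then show ?thesis
      using gp[of i] gp[of l] Suc that by (simp add: inner_diff_right)
  qed
  \<comment> \<open>As a difference of gradients, \<open>H p i\<close> turns conjugacy into
    orthogonality of gradients.\<close>
  have Hp: "H *v p i = (1 / \<theta> i) *\<^sub>R (g (Suc i) - g i)" if "i \<le> m" for i
    using step[of i] \<theta>_nz[OF that] that Suc.prems by simp
  define \<beta> where "\<beta> = (g (Suc m) \<bullet> g (Suc m)) / (g m \<bullet> g m)"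
  have pm: "p (Suc m) = - g (Suc m) + \<beta> *\<^sub>R p m"
    using dir[OF Suc.prems] by (simp add: \<beta>_def)
  \<comment> \<open>For \<open>i = m\<close>, \<beta> is exactly the factor that makes the two
    contributions cancel.\<close>
  have conj: "p (Suc m) \<bullet> (H *v p i) = 0" if "i \<le> m" for i
  proof (cases "i = m")
    case True
    have "p m \<bullet> (H *v p m) = (g m \<bullet> g m) / \<theta> m"
      using \<theta>_eq[of m] \<theta>_nz[of m] by (simp add: field_simps)
    moreover have "g (Suc m) \<bullet> (H *v p m) = (g (Suc m) \<bullet> g (Suc m)) / \<theta> m"
      using g_ortho[of m] by (simp add: Hp inner_diff_right)
    moreover have "g m \<bullet> g m \<noteq> 0" using gg[of m] by simp
    ultimately show ?thesis
      unfolding True pm inner_add_left by (simp add: \<beta>_def)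
  next
    case False
    then have "i < m" using that by simp
    then have "g (Suc m) \<bullet> (H *v p i) = 0"
      using g_ortho[of i] g_ortho[of "Suc i"] by (simp add: Hp inner_diff_right)
    moreover have "p m \<bullet> (H *v p i) = 0" using IH'[of m i] \<open>i < m\<close> by simp
    ultimately show ?thesis unfolding pm inner_add_left by simp
  qed
  have "g (Suc m) \<bullet> p (Suc m) = - (g (Suc m) \<bullet> g (Suc m))"
    using gp[of m] unfolding pm inner_add_right by simp
  then show ?case
    using IH IH' gp g_ortho conj by (auto simp: le_Suc_eq less_Suc_eq_le)
qed

section \<open>Accumulated effect of the updates\<close>

lemma iterated_update_mult_direction:
  assumes step: "\<And>j. j < k \<Longrightarrow> g (Suc j) = g j + step_length H g p j *\<^sub>R (H *v p j)"
    and ortho: "\<And>i j. i < j \<Longrightarrow> j \<le> k \<Longrightarrow> g j \<bullet> p i = 0"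
    and s_nz: "\<And>j. j < k \<Longrightarrow> p j \<bullet> g j \<noteq> 0"
    and Bp: "\<forall>i\<le>k. B i *v p i = - g i"
    and upd: "\<forall>i\<in>{1..k}. \<gamma> i \<noteq> 1 \<and> B i = rank_one_update g p i (\<gamma> i) (B (i - 1))"
    and "i < k"
  shows "B k *v p i = (\<gamma> (i + 1) * step_length H g p i / (\<gamma> (i + 1) - 1)) *\<^sub>R (H *v p i)"
proof -
  have B_Suc: "\<gamma> (Suc j) \<noteq> 1" "B (Suc j) = rank_one_update g p (Suc j) (\<gamma> (Suc j)) (B j)"
    if "j < k" for j
    using upd[rule_format, of "Suc j"] that by auto
  \<comment> \<open>The update with index \<open>i + 1\<close> turns \<open>- g i\<close> into a
    multiple of \<open>g (Suc i) - g i\<close>, which is the step length times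
    \<open>H p i\<close>.\<close>
  have first: "B (Suc i) *v p i
      = (\<gamma> (i + 1) * step_length H g p i / (\<gamma> (i + 1) - 1)) *\<^sub>R (H *v p i)"
  proof -
    define c where "c = \<gamma> (Suc i)"
    have c: "c \<noteq> 1" using B_Suc[OF \<open>i < k\<close>] by (simp add: c_def)
    have "((c *\<^sub>R g (Suc i) - g i) \<bullet> p i) / ((c - 1) * (p i \<bullet> g i)) = - (1 / (c - 1))"
      using ortho[of i "Suc i"] s_nz[OF \<open>i < k\<close>] \<open>i < k\<close>
      by (simp add: inner_diff_left inner_commute[of "p i"])
    then have "B (Suc i) *v p i = - g i + (1 / (c - 1)) *\<^sub>R (c *\<^sub>R g (Suc i) - g i)"
      using B_Suc[OF \<open>i < k\<close>] Bp \<open>i < k\<close> by (simp add: rank_one_update_mult_vec c_def)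
    also have "\<dots> = (c / (c - 1)) *\<^sub>R g (Suc i) - (1 + 1 / (c - 1)) *\<^sub>R g i"
      by (simp add: algebra_simps)
    also have "1 + 1 / (c - 1) = c / (c - 1)" using c by (simp add: field_simps)
    also have "(c / (c - 1)) *\<^sub>R g (Suc i) - (c / (c - 1)) *\<^sub>R g i
        = (c * step_length H g p i / (c - 1)) *\<^sub>R (H *v p i)"
      using step[OF \<open>i < k\<close>] by (simp add: scaleR_add_right)
    finally show ?thesis by (simp add: c_def)
  qed
  \<comment> \<open>From index \<open>i + 1\<close> on, both gradients in the next update are
    orthogonal to \<open>p i\<close>.\<close>
  have "j \<le> k \<longrightarrow> B j *v p i = B (Suc i) *v p i" if "Suc i \<le> j" for j
    using that
  proof (induction j rule: dec_induct)
    case (step j)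
    show ?case
    proof
      assume j: "Suc j \<le> k"
      have "g (Suc j) \<bullet> p i = 0" "g j \<bullet> p i = 0" using ortho step j by auto
      then have "B (Suc j) *v p i = B j *v p i"
        using B_Suc(2)[of j] j by (simp add: rank_one_update_mult_vec inner_diff_left)
      then show "B (Suc j) *v p i = B (Suc i) *v p i" using step j by simp
    qed
  qed simp
  then show ?thesis using first \<open>i < k\<close> by simp
qed

section \<open>The four claims for the scaled CG directions\<close>

theorem proposition4p2:
  fixes H :: "real^'n^'n" and c :: "real^'n"
    and x g p xCG gCG pCG :: "nat \<Rightarrow> real^'n"
    and \<delta> :: "nat \<Rightarrow> real"
    and B :: "nat \<Rightarrow> real^'n^'n"
    and k :: nat
  assumes "transpose H = H" and "pos_def H"
    and "exact_linesearch H c x g p"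
    and "conjugate_gradients H c xCG gCG pCG"
    and "xCG 0 = x 0"
    and "1 \<le> k" and "\<forall>i\<le>k. g i \<noteq> 0"
    and "\<forall>i<k. \<delta> i \<noteq> 0 \<and> p i = \<delta> i *\<^sub>R pCG i"
    and "B k *v p k = - g k"
    and "invertible (B (k - 1))"
    and "B (k - 1) *v p (k - 1) = - g (k - 1)"
    and "B (k - 1) *v g k = g k"
  shows
    "(\<forall>\<gamma>k. \<gamma>k \<noteq> 0 \<and> \<gamma>k \<noteq> gamma_hat g p k \<and> \<gamma>k \<noteq> 1 \<and>
           B k = rank_one_update g p k \<gamma>k (B (k - 1)) \<longrightarrow>
        invertible (B k) \<and> p k = delta_fun g p k \<gamma>k *\<^sub>R pCG k)
   \<and> (\<forall>\<delta>k. \<delta>k \<noteq> 0 \<and> \<delta>k \<noteq> delta_fun g p k 1 \<and> \<delta>k \<noteq> 1 \<and>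
           p k = \<delta>k *\<^sub>R pCG k \<and>
           transpose (B k - B (k - 1)) = B k - B (k - 1) \<and> rank (B k - B (k - 1)) = 1 \<longrightarrow>
        invertible (B k) \<and>
        B k = rank_one_update g p k (gamma_fun g p k \<delta>k) (B (k - 1)))
   \<and> (transpose (B (k - 1)) = B (k - 1) \<and> pos_def (B (k - 1)) \<longrightarrow>
        (\<forall>\<gamma>k. \<gamma>k \<noteq> 0 \<and> \<gamma>k \<noteq> gamma_hat g p k \<and> \<gamma>k \<noteq> 1 \<and>
             B k = rank_one_update g p k \<gamma>k (B (k - 1)) \<longrightarrow>
          (pos_def (B k) \<longleftrightarrow> \<gamma>k > 1 \<or> (gamma_hat g p k < \<gamma>k \<and> \<gamma>k < 0)) \<and>
          (pos_def (B k) \<longleftrightarrow>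
             (\<exists>\<delta>k. \<gamma>k = gamma_fun g p k \<delta>k \<and>
                   ((0 < \<delta>k \<and> \<delta>k < delta_fun g p k 1) \<or> \<delta>k > 1)))))
   \<and> (\<forall>\<gamma> :: nat \<Rightarrow> real.
        (\<forall>i\<le>k. B i *v p i = - g i) \<and> B 0 = mat 1 \<and>
        (\<forall>i\<in>{1..k}. \<gamma> i \<noteq> 0 \<and> \<gamma> i \<noteq> gamma_hat g p i \<and> \<gamma> i \<noteq> 1 \<and>
           B i = rank_one_update g p i (\<gamma> i) (B (i - 1))) \<longrightarrow>
        (\<forall>i<k. B k *v p i =
           (\<gamma> (i + 1) * step_length H g p i / (\<gamma> (i + 1) - 1)) *\<^sub>R (H *v p i)))"
proof -
  note sym = assms(1) and pd = assms(2) and ls = assms(3) and cg = assms(4) and start = assms(5)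
    and k = assms(6) and nz = assms(7) and scaled = assms(8) and Bk = assms(9)
    and inv = assms(10) and B_p = assms(11) and B_g = assms(12)
  have gCG: "gCG i = g i" if "i \<le> k" for i
    using exact_linesearch_scaled_directions[of H c x g p xCG gCG pCG, OF ls _ start nz scaled that] cg
    by (simp add: conjugate_gradients_def)
  then have nzCG: "\<forall>i\<le>k. gCG i \<noteq> 0" using nz by simp
  \<comment> \<open>The gradients of both methods coincide, so the CG relations hold for
    \<open>g\<close>; nonzero scaling then transfers them to \<open>p\<close>.\<close>
  have rel: "g j \<bullet> pCG j = - (g j \<bullet> g j)"
      "i < j \<Longrightarrow> g j \<bullet> g i = 0" "i < j \<Longrightarrow> g j \<bullet> pCG i = 0" if "j \<le> k" for i j
    using conjugate_gradients_relations[OF sym pd cg nzCG that] that gCG by auto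
  have ortho: "g j \<bullet> p i = 0" if "i < j" "j \<le> k" for i j
    using rel(3)[of j i] scaled that by simp
  have pg: "p j \<bullet> g j = - \<delta> j * (g j \<bullet> g j)" if "j < k" for j
    using rel(1)[of j] scaled that by (simp add: inner_commute)
  have pg_nz: "p j \<bullet> g j \<noteq> 0" if "j < k" for j
    using pg[OF that] scaled nz that by simp
  have step: "g (Suc j) = g j + step_length H g p j *\<^sub>R (H *v p j)" if "j < k" for j
    using ls nz that by (simp add: exact_linesearch_def)
  interpret rank_one_step g p k "B (k - 1)"
    by standard (use rel(2)[of k "k - 1"] ortho[of "k - 1" k] nz k pg_nz B_p B_g in auto)
  \<comment> \<open>The factor \<open>\<delta> (k - 1)\<close> occurs in both \<open>s\<close> and
    \<open>p (k - 1)\<close> and cancels in \<open>d\<close>.\<close>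
  have d: "pCG k = d"
  proof -
    have "pCG k = - gCG k + ((gCG k \<bullet> gCG k) / (gCG (k - 1) \<bullet> gCG (k - 1))) *\<^sub>R pCG (k - 1)"
      using cg nzCG k by (simp add: conjugate_gradients_def)
    moreover have "gCG k = g k" "gCG (k - 1) = g (k - 1)" using gCG by auto
    moreover have "\<delta> (k - 1) \<noteq> 0" "p (k - 1) = \<delta> (k - 1) *\<^sub>R pCG (k - 1)"
      using scaled k by auto
    moreover have "s = - \<delta> (k - 1) * (g (k - 1) \<bullet> g (k - 1))"
      using pg[of "k - 1"] k by (simp add: s_def)
    ultimately show ?thesis by (simp add: d_def G_def)
  qed
  show ?thesis
  proof (intro conjI[of "\<forall>\<gamma>k. _ \<gamma>k"] conjI[of "_ \<longrightarrow> _"] allI impI; (elim conjE)?)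
    fix \<gamma>
    assume \<gamma>: "\<gamma> \<noteq> 0" "\<gamma> \<noteq> gamma_hat g p k" "\<gamma> \<noteq> 1"
      and upd: "B k = rank_one_update g p k \<gamma> (B (k - 1))"
    show "invertible (B k) \<and> p k = delta_fun g p k \<gamma> *\<^sub>R pCG k"
      using invertible_update[OF inv \<gamma>] direction_of_update[OF inv \<gamma>] Bk upd d by simp
  next
    fix \<delta>
    assume \<delta>: "\<delta> \<noteq> 0" "\<delta> \<noteq> delta_fun g p k 1" "\<delta> \<noteq> 1"
      and "p k = \<delta> *\<^sub>R pCG k"
      and "transpose (B k - B (k - 1)) = B k - B (k - 1)" "rank (B k - B (k - 1)) = 1"
    then have "B k = rank_one_update g p k (gamma_fun g p k \<delta>) (B (k - 1))"
      using update_of_direction[OF \<delta>] Bk d by simp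
    then show "invertible (B k) \<and>
        B k = rank_one_update g p k (gamma_fun g p k \<delta>) (B (k - 1))"
      using invertible_update[OF inv gamma_fun_admissible[OF \<delta>]] by simp
  next
    fix \<gamma>
    assume B: "transpose (B (k - 1)) = B (k - 1)" "pos_def (B (k - 1))"
      and \<gamma>: "\<gamma> \<noteq> 0" "\<gamma> \<noteq> gamma_hat g p k" "\<gamma> \<noteq> 1"
      and upd: "B k = rank_one_update g p k \<gamma> (B (k - 1))"
    have "pos_def (B k) \<longleftrightarrow> \<gamma> > 1 \<or> (gamma_hat g p k < \<gamma> \<and> \<gamma> < 0)"
      using pos_def_update_iff_factor[OF B \<gamma>(1,3)] factor_pos_iff[OF s_neg[OF B(2)] \<gamma>] upd
      by simp
    then show "(pos_def (B k) \<longleftrightarrow> \<gamma> > 1 \<or> (gamma_hat g p k < \<gamma> \<and> \<gamma> < 0)) \<and>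
          (pos_def (B k) \<longleftrightarrow>
             (\<exists>\<delta>k. \<gamma> = gamma_fun g p k \<delta>k \<and>
                   ((0 < \<delta>k \<and> \<delta>k < delta_fun g p k 1) \<or> \<delta>k > 1)))"
      using ex_gamma_fun_iff[OF s_neg[OF B(2)], of \<gamma>] by simp
  next
    fix \<gamma> :: "nat \<Rightarrow> real" and i
    assume "\<forall>i\<le>k. B i *v p i = - g i"
      and "\<forall>i\<in>{1..k}. \<gamma> i \<noteq> 0 \<and> \<gamma> i \<noteq> gamma_hat g p i \<and> \<gamma> i \<noteq> 1 \<and>
           B i = rank_one_update g p i (\<gamma> i) (B (i - 1))" and "i < k"
    then show "B k *v p i =
        (\<gamma> (i + 1) * step_length H g p i / (\<gamma> (i + 1) - 1)) *\<^sub>R (H *v p i)"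
      by (intro iterated_update_mult_direction step ortho pg_nz) auto
  qed
qed

end
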